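(* Let $s$ and $n$ be positive integers, let $x_1,\dots,x_n$ be independent variables, and write $M_k^{(s)}(n)=M_k^{(s)}(x_1,\dots,x_n)$ and $M_k^{(s)}(n-1)=M_k^{(s)}(x_1,\dots,x_{n-1})$. Then for $k\geq s+1$, \[ M_{k}^{(s)}(n)=\sum_{\substack{0\leq j\leq k\\ j\equiv 0 \text{ or } 1 \pmod{s+1}}}x_{n}^{j}\,M_{k-j}^{(s)}(n-1), \] and \[ M_{k}^{(s)}(n)=x_{n}^{s+1}M_{k-s-1}^{(s)}(n)+x_{n}M_{k-1}^{(s)}(n-1)+M_{k}^{(s)}(n-1). \]
   Context: For integers $s\ge 1$, $m\ge 0$, $k\ge 0$, the modular symmetric function is \[ M_{k}^{(s)}(x_{1},\ldots,x_{m})=\sum x_{1}^{a_{1}}\cdots x_{m}^{a_{m}}, \] where the sum runs over all $m$-tuples $(a_1,\dots,a_m)$ of nonnegative integers with $a_1+\cdots+a_m=k$ and each $a_i\equiv 0$ or $a_i\equiv 1 \pmod{s+1}$. For zero variables ($m=0$), $M_k^{(s)}()=\delta_{k,0}$ (Kronecker delta). *)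

theory Defs
  imports "HOL-Library.FuncSet" "HOL-Library.Poly_Mapping" "HOL-Number_Theory.Cong"
begin

text \<open>
  Exponent tuples \<open>(a\<^sub>1, \<dots>, a\<^sub>m)\<close> are extensional functions on \<open>{1..m}\<close>, so that each
  tuple is represented exactly once; for \<open>m = 0\<close> there is exactly one (empty) tuple.
\<close>

definition modular_exponents :: "nat \<Rightarrow> nat \<Rightarrow> nat \<Rightarrow> (nat \<Rightarrow> nat) set" where
  "modular_exponents s k m =
     {a \<in> {1..m} \<rightarrow>\<^sub>E UNIV. (\<Sum>i=1..m. a i) = k \<and>
        (\<forall>i\<in>{1..m}. [a i = 0] (mod (s + 1)) \<or> [a i = 1] (mod (s + 1)))}"

definition modular_sym ::
    "nat \<Rightarrow> nat \<Rightarrow> nat \<Rightarrow> (nat \<Rightarrow> 'a::comm_semiring_1) \<Rightarrow> 'a" where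
  "modular_sym s k m x = (\<Sum>a\<in>modular_exponents s k m. \<Prod>i=1..m. x i ^ a i)"

text \<open>The sum above is never the junk value of a sum over an infinite set.\<close>

lemma finite_modular_exponents: "finite (modular_exponents s k m)"
proof (rule finite_subset)
  show "modular_exponents s k m \<subseteq> {1..m} \<rightarrow>\<^sub>E {..k}"
  proof
    fix a assume a: "a \<in> modular_exponents s k m"
    have "a i \<le> k" if "i \<in> {1..m}" for i
      using a member_le_sum[of i "{1..m}" a] that by (simp add: modular_exponents_def)
    with a show "a \<in> {1..m} \<rightarrow>\<^sub>E {..k}"
      by (auto simp: modular_exponents_def PiE_def Pi_def)
  qed
  show "finite ({1..m} \<rightarrow>\<^sub>E {..k})"
    by (intro finite_PiE) auto
qed

lemma modular_sym_no_variables: "modular_sym s k 0 x = (if k = 0 then 1 else 0)"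
proof -
  have "modular_exponents s k 0 = (if k = 0 then {\<lambda>_. undefined} else {})"
    by (auto simp: modular_exponents_def)
  then show ?thesis
    by (simp add: modular_sym_def)
qed

text \<open>
  Polynomials over \<open>'a\<close> in the indeterminates \<open>X\<^sub>i\<close> (\<open>i :: nat\<close>): finitely supported maps
  from monomials to coefficients, where a monomial is a finitely supported exponent vector.
  Multiplication is the convolution product of \<open>poly_mapping\<close>.
\<close>

type_synonym 'a mpoly = "(nat \<Rightarrow>\<^sub>0 nat) \<Rightarrow>\<^sub>0 'a"

definition indet :: "nat \<Rightarrow> 'a::comm_ring_1 mpoly" where
  "indet i = Poly_Mapping.single (Poly_Mapping.single i 1) 1"

end

theory Submission
  imports Defs
begin

text \<open>
  Splitting off the exponent \<open>j\<close> of the last variable gives the first identity. The second one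
  follows from it because the exponents \<open>j \<ge> s + 1\<close> are exactly the admissible exponents
  shifted by \<open>s + 1\<close>, so that they contribute \<open>x\<^sub>n\<^bsup>s+1\<^esup>\<close> times the same expansion of
  \<open>M\<^bsub>k-s-1\<^esub>(n)\<close>; the exponents that remain are \<open>0\<close> and \<open>1\<close>.
\<close>

definition modular_degrees :: "nat \<Rightarrow> nat \<Rightarrow> nat set" where
  "modular_degrees s k = {j. j \<le> k \<and> ([j = 0] (mod (s + 1)) \<or> [j = 1] (mod (s + 1)))}"

lemma finite_modular_degrees: "finite (modular_degrees s k)"
  by (rule finite_subset[of _ "{..k}"]) (auto simp: modular_degrees_def)

text \<open>Below \<open>s + 1\<close> a number is its own residue, so only 0 and 1 are admissible
  there; from \<open>s + 1\<close> on, subtracting the modulus keeps the residue.\<close>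

lemma modular_degrees_unfold:
  assumes "s \<ge> 1" and "k \<ge> s + 1"
  shows "modular_degrees s k = insert 0 (insert 1 ((+) (s + 1) ` modular_degrees s (k - (s + 1))))"
    (is "?L = ?R")
proof
  show "?L \<subseteq> ?R"
  proof
    fix j assume j: "j \<in> ?L"
    show "j \<in> ?R"
    proof (cases "j < s + 1")
      case True
      with j assms show ?thesis by (auto simp: modular_degrees_def cong_def)
    next
      case False
      then obtain i where "j = (s + 1) + i" using le_Suc_ex[of "s + 1" j] by auto
      with j have "i \<in> modular_degrees s (k - (s + 1))"
        \<comment> \<open>The flipped \<open>add_Suc\<close> keeps the summand \<open>Suc s\<close>
          visible, so that it cancels modulo \<open>s + 1\<close>.\<close>
        by (auto simp: modular_degrees_def cong_def simp flip: add_Suc)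
      with \<open>j = (s + 1) + i\<close> show ?thesis by blast
    qed
  qed
  show "?R \<subseteq> ?L"
    using assms by (auto simp: modular_degrees_def cong_def simp flip: add_Suc)
qed

text \<open>With the next lemma, this gives the two directions of the bijection between longer
  tuples and pairs of a last exponent and a shorter tuple.\<close>

lemma modular_exponents_fun_upd:
  "a(Suc m := j) \<in> modular_exponents s k (Suc m)"
  if "j \<in> modular_degrees s k" "a \<in> modular_exponents s (k - j) m"
  using that
  by (auto simp: modular_exponents_def modular_degrees_def PiE_def extensional_def)

lemma modular_exponents_restrict:
  assumes "a \<in> modular_exponents s k (Suc m)"
  shows "a (Suc m) \<in> modular_degrees s k"
    and "a(Suc m := undefined) \<in> modular_exponents s (k - a (Suc m)) m"
  using assms
  by (auto simp: modular_exponents_def modular_degrees_def PiE_def extensional_def)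

lemma modular_sym_Suc:
  "modular_sym s k (Suc m) x =
     (\<Sum>j\<in>modular_degrees s k. x (Suc m) ^ j * modular_sym s (k - j) m x)"
proof -
  \<comment> \<open>Tuples are extensional, so erasing the last exponent means resetting it to
    \<open>undefined\<close>; this makes the two maps below mutually inverse.\<close>
  have undef: "a (Suc m) = undefined" if "a \<in> modular_exponents s l m" for a l
    using that by (auto simp: modular_exponents_def PiE_def extensional_def)
  have "(\<Sum>j\<in>modular_degrees s k. x (Suc m) ^ j * modular_sym s (k - j) m x) =
      (\<Sum>(j, a)\<in>(SIGMA j:modular_degrees s k. modular_exponents s (k - j) m).
         x (Suc m) ^ j * (\<Prod>i=1..m. x i ^ a i))"
    by (simp add: modular_sym_def sum_distrib_left sum.Sigma finite_modular_degrees
        finite_modular_exponents)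
  also have "\<dots> = modular_sym s k (Suc m) x"
    unfolding modular_sym_def
    by (rule sum.reindex_bij_witness[where
          j = "\<lambda>(j, a). a(Suc m := j)" and i = "\<lambda>a. (a (Suc m), a(Suc m := undefined))"])
      (auto simp: modular_exponents_fun_upd modular_exponents_restrict undef fun_upd_idem_iff
        mult.commute)
  finally show ?thesis ..
qed

lemma modular_sym_Suc_recurrence:
  assumes "s \<ge> 1" and "k \<ge> s + 1"
  shows "modular_sym s k (Suc m) x =
     x (Suc m) ^ (s + 1) * modular_sym s (k - s - 1) (Suc m) x
     + x (Suc m) * modular_sym s (k - 1) m x + modular_sym s k m x"
proof -
  let ?D = "modular_degrees s (k - (s + 1))"
  have "modular_sym s k (Suc m) x =
      modular_sym s k m x + (x (Suc m) * modular_sym s (k - 1) m x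
      + (\<Sum>j\<in>(+) (s + 1) ` ?D. x (Suc m) ^ j * modular_sym s (k - j) m x))"
  proof -
    \<comment> \<open>The terms for 0 and 1 split off only if they do not recur among the shifted
      exponents; for 1 this uses \<open>s \<ge> 1\<close>.\<close>
    have "0 \<notin> insert 1 ((+) (s + 1) ` ?D)" "1 \<notin> (+) (s + 1) ` ?D"
      using assms(1) by auto
    then show ?thesis
      unfolding modular_sym_Suc[of s k] modular_degrees_unfold[OF assms]
      by (subst sum.insert; simp add: finite_modular_degrees)+
  qed
  also have "(\<Sum>j\<in>(+) (s + 1) ` ?D. x (Suc m) ^ j * modular_sym s (k - j) m x) =
      x (Suc m) ^ (s + 1) * modular_sym s (k - s - 1) (Suc m) x"
    \<comment> \<open>Expanding the right-hand side in the last variable as well lets both sums be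
      compared term by term once \<open>s + 1\<close> is factored out of the exponents.\<close>
    unfolding modular_sym_Suc[of s "k - s - 1"]
    by (subst sum.reindex)
      (auto simp: sum_distrib_left power_add mult_ac intro!: sum.cong)
  finally show ?thesis by (simp add: add_ac)
qed

theorem theorem2p2:
  fixes s n k :: nat
  assumes "s \<ge> 1" and "n \<ge> 1" and "k \<ge> s + 1"
  shows "(modular_sym s k n indet :: 'a::comm_ring_1 mpoly) =
           (\<Sum>j | 0 \<le> j \<and> j \<le> k \<and> ([j = 0] (mod (s + 1)) \<or> [j = 1] (mod (s + 1))).
              indet n ^ j * modular_sym s (k - j) (n - 1) indet)
       \<and> (modular_sym s k n indet :: 'a mpoly) =
           indet n ^ (s + 1) * modular_sym s (k - s - 1) n indet
           + indet n * modular_sym s (k - 1) (n - 1) indet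
           + modular_sym s k (n - 1) indet"
proof -
  \<comment> \<open>Positivity of \<open>n\<close> provides a last variable to split off, and
    \<open>n - 1\<close> becomes \<open>m\<close>.\<close>
  obtain m where n: "n = Suc m"
    using assms(2) by (cases n) auto
  show ?thesis
    using modular_sym_Suc[of s k m "indet :: nat \<Rightarrow> 'a mpoly"]
      modular_sym_Suc_recurrence[OF assms(1,3), of m "indet :: nat \<Rightarrow> 'a mpoly"]
    by (simp add: n modular_degrees_def)
qed

end
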